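(* Let $t\in\mathbb{N}$. Checking whether a set function $f:2^\Omega\to\mathbb{R}$, where $|\Omega|=n$, is $t$-sos-submodular amounts to solving a semidefinite program (SDP) with $\frac{n(n-1)}{2}$ semidefinite constraints, each of size $\sum_{k=0}^t\binom{n-2}{k}$.
   Context: $\Omega$ is a set of cardinality $n$, identified with $\{1,\dots,n\}$, and a set function is a function $f:2^\Omega\to\mathbb{R}$. The multilinear extension (MLE) of $f$ is the unique multilinear polynomial $F\in\mathbb{R}[x_1,\dots,x_n]$ (every variable appears with power at most $1$ in every monomial) with $F(1_S)=f(S)$ for all $S\subseteq\Omega$, where $1_S\in\{0,1\}^n$ is the indicator vector of $S$. The set function $f$ is assumed to be given through its MLE $F$. For an ideal $I$ of a real polynomial ring, a polynomial $p$ is $t$-sos modulo $I$ if there are finitely many polynomials $q_1,\dots,q_m$ in that ring, each of degree at most $t$, with $p-\sum_{r=1}^m q_r^2\in I$. For $i\ne j$, $x_{-i,j}$ denotes the vector of variables $x_1,\dots,x_n$ with $x_i,x_j$ removed, and $I_2[x_{-i,j}]$ is the ideal of $\mathbb{R}[x_{-i,j}]$ generated by the polynomials $x_k^2-x_k$, $k\in\{1,\dots,n\}\setminus\{i,j\}$. The set function $f$ with MLE $F$ is $t$-sos-submodular if for all $i\neq j$ in $\{1,\dots,n\}$ the polynomial $-\frac{\partial^2F(x)}{\partial x_i\partial x_j}$ (which does not involve $x_i,x_j$, by multilinearity of $F$) is $t$-sos modulo $I_2[x_{-i,j}]$. *)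

theory Defs
  imports
    "HOL-Library.Poly_Mapping"
    "HOL-Library.Indicator_Function"
    "Jordan_Normal_Form.Matrix"
begin

section \<open>Real polynomials in variables indexed by natural numbers\<close>

text \<open>A monomial is its finitely supported exponent vector and a polynomial is its finitely
  supported coefficient function; sums and products are those of
  \<^theory>\<open>HOL-Library.Poly_Mapping\<close>.\<close>

type_synonym monomial = "nat \<Rightarrow>\<^sub>0 nat"
type_synonym mpoly = "monomial \<Rightarrow>\<^sub>0 real"

definition mvar :: "nat \<Rightarrow> mpoly" where
  "mvar k = Poly_Mapping.single (Poly_Mapping.single k 1) 1"

text \<open>The squarefree monomial \<open>\<Prod>k\<in>S. x\<^sub>k\<close>.\<close>

definition sqfree_monomial :: "nat set \<Rightarrow> monomial" where
  "sqfree_monomial S = (\<Sum>k\<in>S. Poly_Mapping.single k 1)"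

text \<open>The subring of polynomials that only involve variables from \<open>V\<close>.\<close>

definition polys_in :: "nat set \<Rightarrow> mpoly set" where
  "polys_in V = {p. \<forall>m \<in> Poly_Mapping.keys p. Poly_Mapping.keys m \<subseteq> V}"

definition monomial_degree :: "monomial \<Rightarrow> nat" where
  "monomial_degree m = (\<Sum>k\<in>Poly_Mapping.keys m. Poly_Mapping.lookup m k)"

text \<open>The zero polynomial gets degree 0, so it satisfies every degree bound below.\<close>

definition total_degree :: "mpoly \<Rightarrow> nat" where
  "total_degree p = Max (insert 0 (monomial_degree ` Poly_Mapping.keys p))"

definition multilinear :: "mpoly \<Rightarrow> bool" where
  "multilinear p \<longleftrightarrow> (\<forall>m \<in> Poly_Mapping.keys p. \<forall>k. Poly_Mapping.lookup m k \<le> 1)"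

definition eval_mpoly :: "mpoly \<Rightarrow> (nat \<Rightarrow> real) \<Rightarrow> real" where
  "eval_mpoly p x =
     (\<Sum>m\<in>Poly_Mapping.keys p. Poly_Mapping.lookup p m *
        (\<Prod>k\<in>Poly_Mapping.keys m. x k ^ Poly_Mapping.lookup m k))"

text \<open>Where \<open>x\<^sub>i\<close> does not occur in \<open>m\<close>, the truncated difference of exponents is harmless because
  the coefficient vanishes.\<close>

definition partial_deriv :: "nat \<Rightarrow> mpoly \<Rightarrow> mpoly" where
  "partial_deriv i p =
     (\<Sum>m\<in>Poly_Mapping.keys p.
        Poly_Mapping.single (m - Poly_Mapping.single i 1)
          (of_nat (Poly_Mapping.lookup m i) * Poly_Mapping.lookup p m))"

text \<open>The ideal of the subring \<open>R\<close> generated by \<open>G \<subseteq> R\<close>.\<close>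

definition ideal_in :: "mpoly set \<Rightarrow> mpoly set \<Rightarrow> mpoly set" where
  "ideal_in R G =
     {p. \<exists>G' h. finite G' \<and> G' \<subseteq> G \<and> (\<forall>g\<in>G'. h g \<in> R) \<and> p = (\<Sum>g\<in>G'. h g * g)}"


section \<open>Sum-of-squares submodularity\<close>

text \<open>The ground set is \<open>{1..n}\<close>; only the values of \<open>f\<close> on subsets of \<open>{1..n}\<close> matter.\<close>

definition is_mle :: "nat \<Rightarrow> (nat set \<Rightarrow> real) \<Rightarrow> mpoly \<Rightarrow> bool" where
  "is_mle n f F \<longleftrightarrow> F \<in> polys_in {1..n} \<and> multilinear F \<and>
     (\<forall>S\<subseteq>{1..n}. eval_mpoly F (indicator S) = f S)"

definition mle :: "nat \<Rightarrow> (nat set \<Rightarrow> real) \<Rightarrow> mpoly" where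
  "mle n f = (THE F. is_mle n f F)"

definition boolean_ideal :: "nat set \<Rightarrow> mpoly set" where
  "boolean_ideal V = ideal_in (polys_in V) {mvar k ^ 2 - mvar k | k. k \<in> V}"

definition sos_modulo :: "nat \<Rightarrow> nat set \<Rightarrow> mpoly set \<Rightarrow> mpoly \<Rightarrow> bool" where
  "sos_modulo t V I p \<longleftrightarrow>
     (\<exists>qs :: mpoly list. (\<forall>q \<in> set qs. q \<in> polys_in V \<and> total_degree q \<le> t) \<and>
        p - (\<Sum>q\<leftarrow>qs. q ^ 2) \<in> I)"

definition sos_submodular :: "nat \<Rightarrow> nat \<Rightarrow> (nat set \<Rightarrow> real) \<Rightarrow> bool" where
  "sos_submodular n t f \<longleftrightarrow>
     (\<forall>i\<in>{1..n}. \<forall>j\<in>{1..n}. i \<noteq> j \<longrightarrow>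
        sos_modulo t ({1..n} - {i, j}) (boolean_ideal ({1..n} - {i, j}))
          (- partial_deriv i (partial_deriv j (mle n f))))"


section \<open>Semidefinite programs\<close>

definition psd_matrix :: "nat \<Rightarrow> real mat \<Rightarrow> bool" where
  "psd_matrix s X \<longleftrightarrow> X \<in> carrier_mat s s \<and> transpose_mat X = X \<and>
     (\<forall>v \<in> carrier_vec s. v \<bullet> (X *\<^sub>v v) \<ge> 0)"

definition mat_inner :: "real mat \<Rightarrow> real mat \<Rightarrow> real" where
  "mat_inner A X = (\<Sum>i<dim_row A. \<Sum>j<dim_col A. A $$ (i, j) * X $$ (i, j))"

text \<open>A semidefinite feasibility program in standard form: find matrices \<open>X\<^sub>0, X\<^sub>1, \<dots>\<close>,
  where \<open>X\<^sub>r\<close> is positive semidefinite of size \<open>block_sizes ! r\<close>, subject to finitely many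
  equations \<open>(\<Sum>r. \<langle>A\<^sub>r, X\<^sub>r\<rangle>) = b\<close>. Its semidefinite constraints are the entries of
  \<open>block_sizes\<close>.\<close>

record sdp =
  block_sizes :: "nat list"
  equations :: "(real mat list \<times> real) list"

definition sdp_wf :: "sdp \<Rightarrow> bool" where
  "sdp_wf P \<longleftrightarrow> (\<forall>(As, b) \<in> set (equations P).
     length As = length (block_sizes P) \<and>
     (\<forall>r < length (block_sizes P).
        As ! r \<in> carrier_mat (block_sizes P ! r) (block_sizes P ! r) \<and>
        transpose_mat (As ! r) = As ! r))"

definition sdp_feasible :: "sdp \<Rightarrow> bool" where
  "sdp_feasible P \<longleftrightarrow> (\<exists>Xs.
     length Xs = length (block_sizes P) \<and>
     (\<forall>r < length (block_sizes P). psd_matrix (block_sizes P ! r) (Xs ! r)) \<and>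
     (\<forall>(As, b) \<in> set (equations P).
        (\<Sum>r < length (block_sizes P). mat_inner (As ! r) (Xs ! r)) = b))"

text \<open>The program whose block sizes and left-hand sides are fixed, and whose right-hand sides are
  fixed linear forms \<open>\<beta>\<close> in the coefficients of the multilinear polynomial \<open>F\<close> in
  \<open>x\<^sub>1, \<dots>, x\<^sub>n\<close>.\<close>

definition sdp_at ::
    "nat \<Rightarrow> nat list \<Rightarrow> (real mat list \<times> (nat set \<Rightarrow> real)) list \<Rightarrow> mpoly \<Rightarrow> sdp" where
  "sdp_at n sizes eqs F =
     \<lparr> block_sizes = sizes,
       equations = map (\<lambda>(As, \<beta>).
         (As, \<Sum>S\<in>Pow {1..n}. \<beta> S * Poly_Mapping.lookup F (sqfree_monomial S))) eqs \<rparr>"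


section \<open>Existence and uniqueness of the multilinear extension\<close>

lemma lookup_sqfree_monomial:
  "finite S \<Longrightarrow> Poly_Mapping.lookup (sqfree_monomial S) k = (if k \<in> S then 1 else 0)"
  by (simp add: sqfree_monomial_def lookup_sum lookup_single when_def sum.delta)

lemma keys_sqfree_monomial: "finite S \<Longrightarrow> Poly_Mapping.keys (sqfree_monomial S) = S"
  by (auto simp: in_keys_iff lookup_sqfree_monomial split: if_splits)

lemma multilinear_key_eq:
  assumes "multilinear F" "m \<in> Poly_Mapping.keys F"
  shows "m = sqfree_monomial (Poly_Mapping.keys m)"
proof (rule poly_mapping_eqI)
  fix k
  have "Poly_Mapping.lookup m k \<le> 1" using assms by (auto simp: multilinear_def)
  then show "Poly_Mapping.lookup m k
      = Poly_Mapping.lookup (sqfree_monomial (Poly_Mapping.keys m)) k"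
    by (auto simp: lookup_sqfree_monomial in_keys_iff)
qed

lemma inj_sqfree_monomial: "finite V \<Longrightarrow> inj_on sqfree_monomial (Pow V)"
  by (rule inj_onI) (metis PowD finite_subset keys_sqfree_monomial)

lemma multilinear_keys_subset:
  assumes "multilinear F" "F \<in> polys_in V"
  shows "Poly_Mapping.keys F \<subseteq> sqfree_monomial ` Pow V"
proof
  fix m assume m: "m \<in> Poly_Mapping.keys F"
  then have "Poly_Mapping.keys m \<in> Pow V" using assms by (auto simp: polys_in_def)
  with multilinear_key_eq[OF assms(1) m] show "m \<in> sqfree_monomial ` Pow V" by blast
qed

lemma eval_multilinear_indicator:
  assumes F: "multilinear F" "F \<in> polys_in V" and V: "finite V" and S: "S \<subseteq> V"
  shows "eval_mpoly F (indicator S)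
    = (\<Sum>T\<in>Pow S. Poly_Mapping.lookup F (sqfree_monomial T))"
proof -
  let ?g = "\<lambda>m. Poly_Mapping.lookup F m *
    (\<Prod>k\<in>Poly_Mapping.keys m. (indicator S k :: real) ^ Poly_Mapping.lookup m k)"
  have "eval_mpoly F (indicator S) = sum ?g (sqfree_monomial ` Pow V)"
    unfolding eval_mpoly_def
    by (rule sum.mono_neutral_left)
       (use multilinear_keys_subset[OF F] V in \<open>auto simp: in_keys_iff\<close>)
  also have "\<dots> = (\<Sum>T\<in>Pow V. ?g (sqfree_monomial T))"
    by (simp add: sum.reindex[OF inj_sqfree_monomial[OF V]])
  also have "\<dots> = (\<Sum>T\<in>Pow V. if T \<subseteq> S then Poly_Mapping.lookup F (sqfree_monomial T) else 0)"
  proof (rule sum.cong[OF refl])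
    fix T assume "T \<in> Pow V"
    then have T: "finite T" using V finite_subset by auto
    have "(\<Prod>k\<in>T. (indicator S k :: real)) = (if T \<subseteq> S then 1 else 0)"
    proof (cases "T \<subseteq> S")
      case True
      then have "(\<Prod>k\<in>T. (indicator S k :: real)) = 1"
        by (intro prod.neutral) (auto simp: indicator_def)
      with True show ?thesis by simp
    next
      case False
      then obtain k where "k \<in> T" "k \<notin> S" by blast
      then have "(\<Prod>k\<in>T. (indicator S k :: real)) = 0"
        by (intro prod_zero[OF T]) (auto simp: indicator_def)
      with False show ?thesis by simp
    qed
    then show "?g (sqfree_monomial T)
        = (if T \<subseteq> S then Poly_Mapping.lookup F (sqfree_monomial T) else 0)"
      using T by (simp add: keys_sqfree_monomial lookup_sqfree_monomial)
  qed
  also have "\<dots> = (\<Sum>T\<in>Pow S. Poly_Mapping.lookup F (sqfree_monomial T))"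
    by (rule sum.mono_neutral_cong_right) (use V S in auto)
  finally show ?thesis .
qed

lemma is_mle_exists: "\<exists>F. is_mle n f F"
proof -
  define V where "V = {1..n}"
  have V: "finite V" by (simp add: V_def)
  define c :: "nat set \<Rightarrow> real" where
    "c T = (-1) ^ card T * (\<Sum>U\<in>Pow T. (-1) ^ card U * f U)" for T
  define F :: mpoly where "F = (\<Sum>T\<in>Pow V. Poly_Mapping.single (sqfree_monomial T) (c T))"
  have keys: "Poly_Mapping.keys F \<subseteq> sqfree_monomial ` Pow V"
  proof
    fix m assume "m \<in> Poly_Mapping.keys F"
    then have "(\<Sum>T\<in>Pow V. c T when sqfree_monomial T = m) \<noteq> 0"
      by (simp add: in_keys_iff F_def lookup_sum lookup_single)
    then obtain T where "T \<in> Pow V" "(c T when sqfree_monomial T = m) \<noteq> 0"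
      by (meson sum.not_neutral_contains_not_neutral)
    then show "m \<in> sqfree_monomial ` Pow V" by (auto simp: when_def split: if_splits)
  qed
  have lookup: "Poly_Mapping.lookup F (sqfree_monomial S) = c S" if "S \<in> Pow V" for S
  proof -
    have "Poly_Mapping.lookup F (sqfree_monomial S)
        = (\<Sum>T\<in>Pow V. if T = S then c T else 0)"
      unfolding F_def lookup_sum lookup_single
      by (rule sum.cong)
         (use that inj_sqfree_monomial[OF V] in \<open>auto simp: when_def inj_on_def\<close>)
    then show ?thesis using that V by simp
  qed
  have key: "\<exists>T. T \<subseteq> V \<and> finite T \<and> m = sqfree_monomial T"
    if "m \<in> Poly_Mapping.keys F" for m
  proof -
    obtain T where T: "T \<in> Pow V" "m = sqfree_monomial T" using keys \<open>m \<in> Poly_Mapping.keys F\<close> by blast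
    moreover have "finite T" using T(1) V by (simp add: finite_subset)
    ultimately show ?thesis by blast
  qed
  have ml: "multilinear F"
    unfolding multilinear_def
  proof (intro ballI allI)
    fix m k assume "m \<in> Poly_Mapping.keys F"
    then obtain T where "finite T" "m = sqfree_monomial T" using key by blast
    then show "Poly_Mapping.lookup m k \<le> 1" by (simp add: lookup_sqfree_monomial)
  qed
  have inV: "F \<in> polys_in V"
    unfolding polys_in_def
  proof (intro CollectI ballI)
    fix m assume "m \<in> Poly_Mapping.keys F"
    then obtain T where "T \<subseteq> V" "finite T" "m = sqfree_monomial T" using key by blast
    then show "Poly_Mapping.keys m \<subseteq> V" by (simp add: keys_sqfree_monomial)
  qed
  have "eval_mpoly F (indicator S) = f S" if S: "S \<subseteq> V" for S
  proof -
    have "f S = (\<Sum>T\<in>Pow S. (-1) ^ card T * (\<Sum>U\<in>Pow T. (-1) ^ card U * f U))"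
      by (rule inclusion_exclusion_symmetric[OF refl]) (use S V finite_subset in auto)
    also have "\<dots> = (\<Sum>T\<in>Pow S. Poly_Mapping.lookup F (sqfree_monomial T))"
      using S by (intro sum.cong) (auto simp: c_def lookup)
    finally show ?thesis using eval_multilinear_indicator[OF ml inV V S] by simp
  qed
  with ml inV show ?thesis unfolding is_mle_def V_def by blast
qed

lemma is_mle_unique:
  assumes F: "is_mle n f F" and G: "is_mle n f G"
  shows "F = G"
proof -
  let ?V = "{1..n}"
  have eq: "Poly_Mapping.lookup F (sqfree_monomial S) = Poly_Mapping.lookup G (sqfree_monomial S)"
    if "S \<subseteq> ?V" for S
  proof -
    have "finite S" using that finite_subset by blast
    then show ?thesis using that
    proof (induction S rule: finite_psubset_induct)
      case (psubset S)
      have "(\<Sum>T\<in>Pow S. Poly_Mapping.lookup F (sqfree_monomial T))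
          = (\<Sum>T\<in>Pow S. Poly_Mapping.lookup G (sqfree_monomial T))"
        using F G psubset.prems eval_multilinear_indicator[of F ?V S]
          eval_multilinear_indicator[of G ?V S]
        by (auto simp: is_mle_def)
      moreover have "(\<Sum>T\<in>Pow S - {S}. Poly_Mapping.lookup F (sqfree_monomial T))
          = (\<Sum>T\<in>Pow S - {S}. Poly_Mapping.lookup G (sqfree_monomial T))"
      proof (rule sum.cong[OF refl])
        fix T assume "T \<in> Pow S - {S}"
        then have "T \<subset> S" by blast
        then show "Poly_Mapping.lookup F (sqfree_monomial T)
            = Poly_Mapping.lookup G (sqfree_monomial T)"
          using psubset.IH[of T] psubset.prems by blast
      qed
      ultimately show ?case
        using psubset.hyps by (simp add: sum.remove[of "Pow S" S])
    qed
  qed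
  show ?thesis
  proof (rule poly_mapping_eqI)
    fix m
    show "Poly_Mapping.lookup F m = Poly_Mapping.lookup G m"
    proof (cases "m \<in> sqfree_monomial ` Pow ?V")
      case True
      then show ?thesis using eq by auto
    next
      case False
      then have "m \<notin> Poly_Mapping.keys F" "m \<notin> Poly_Mapping.keys G"
        using multilinear_keys_subset[of F ?V] multilinear_keys_subset[of G ?V] F G
        by (auto simp: is_mle_def)
      then show ?thesis by (simp add: in_keys_iff)
    qed
  qed
qed

lemma is_mle_mle: "is_mle n f (mle n f)"
  unfolding mle_def by (rule theI') (use is_mle_exists is_mle_unique in blast)

end

theory Submission
  imports Defs
begin

text \<open>Fix a pair \<open>i < j\<close>, put \<open>V = {1..n} - {i, j}\<close> and \<open>p = - \<partial>\<^sub>i \<partial>\<^sub>j F\<close>. Two polynomials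
  in the variables \<open>V\<close> agree modulo the ideal generated by the \<open>x\<^sub>k\<^sup>2 - x\<^sub>k\<close> exactly when they take the
  same value at every point of the cube \<open>{0,1}\<^sup>V\<close> (\<open>boolean_ideal_iff_vanishes_on_cube\<close>). On the cube a
  polynomial \<open>q\<close> of degree at most \<open>t\<close> is a linear combination of the squarefree monomials \<open>x\<^sup>B\<close> with
  \<open>B \<subseteq> V\<close> and \<open>|B| \<le> t\<close>, of which there are \<open>\<Sum>k\<le>t. (n-2 choose k)\<close>. So \<open>p\<close> is \<open>t\<close>-sos modulo the
  ideal iff there are coefficient vectors \<open>u\<close> with
  \<open>p(1\<^sub>S) = (\<Sum>\<^sub>u. (\<Sum>\<^sub>B. [B \<subseteq> S] u\<^sub>B)\<^sup>2)\<close> for all \<open>S \<subseteq> V\<close>.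

  Writing \<open>v\<^sub>S\<close> for the 0/1 vector with entries \<open>[B \<subseteq> S]\<close> and \<open>X = (\<Sum>\<^sub>u. u u\<^sup>T)\<close>, the right-hand side is
  \<open>\<langle>v\<^sub>S v\<^sub>S\<^sup>T, X\<rangle>\<close>, and the matrices \<open>X\<close> of this form are precisely the positive semidefinite ones
  (\<open>psd_matrix_iff_gram\<close>). Hence the condition for the pair is the feasibility of one semidefinite
  block with one linear equation for each \<open>S \<subseteq> V\<close> (\<open>sos_modulo_iff_psd_matrix\<close>). The matrix
  \<open>v\<^sub>S v\<^sub>S\<^sup>T\<close> does not depend on \<open>F\<close>, and
  \<open>p(1\<^sub>S) = - (\<Sum>T\<subseteq>S. coefficient of F at T \<union> {i, j})\<close> is a fixed linear form in the coefficients of \<open>F\<close>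
  (\<open>eval_neg_second_partial\<close>).

  Since partial derivatives commute, the unordered pairs suffice, and placing the blocks of the
  \<open>n (n - 1) / 2\<close> pairs side by side gives the program (\<open>sdp_feasible_separable\<close>).

  Using the values on the cube, instead of comparing coefficients of reduced polynomials, avoids
  reducing the squares \<open>q\<^sup>2\<close> modulo the ideal, because evaluation at a point is multiplicative.\<close>

section \<open>Positive semidefinite forms are sums of squares\<close>

lemma quadratic_form_insert:
  fixes Q :: "'a \<Rightarrow> 'a \<Rightarrow> real"
  assumes "finite I" "k \<notin> I" "\<And>i. i \<in> I \<Longrightarrow> Q i k = Q k i"
  shows "(\<Sum>i\<in>insert k I. \<Sum>j\<in>insert k I. x i * Q i j * x j)
    = Q k k * (x k)\<^sup>2 + 2 * x k * (\<Sum>i\<in>I. Q k i * x i) + (\<Sum>i\<in>I. \<Sum>j\<in>I. x i * Q i j * x j)"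
proof -
  have "(\<Sum>i\<in>I. x i * Q i k * x k) = x k * (\<Sum>i\<in>I. Q k i * x i)"
    using assms(3) by (auto simp: sum_distrib_left intro!: sum.cong)
  moreover have "(\<Sum>j\<in>I. x k * Q k j * x j) = x k * (\<Sum>i\<in>I. Q k i * x i)"
    by (simp add: sum_distrib_left mult.assoc)
  ultimately show ?thesis
    using assms(1,2) by (simp add: sum.distrib power2_eq_square algebra_simps)
qed

text \<open>Symmetric Gaussian elimination. If the diagonal entry \<open>d = Q k k\<close> is positive, subtracting
  the rank-one form \<open>Q k i * Q k j / d\<close> removes the row and column of \<open>k\<close>, and the remaining form is
  still nonnegative because its value at \<open>x\<close> is the minimum of the value of \<open>Q\<close> over all choices of
  the coordinate at \<open>k\<close>. If \<open>d = 0\<close>, nonnegativity forces the whole row of \<open>k\<close> to vanish; as division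
  by \<open>0\<close> yields \<open>0\<close>, the same formulas cover this case.\<close>

lemma psd_form_is_gram:
  fixes Q :: "'a \<Rightarrow> 'a \<Rightarrow> real"
  assumes "finite I"
    and "\<And>i j. i \<in> I \<Longrightarrow> j \<in> I \<Longrightarrow> Q i j = Q j i"
    and "\<And>x. (\<Sum>i\<in>I. \<Sum>j\<in>I. x i * Q i j * x j) \<ge> 0"
  shows "\<exists>us :: ('a \<Rightarrow> real) list. \<forall>i\<in>I. \<forall>j\<in>I. Q i j = (\<Sum>u\<leftarrow>us. u i * u j)"
  using assms
proof (induction I arbitrary: Q rule: finite_induct)
  case empty
  then show ?case by simp
next
  case (insert k I)
  define d where "d = Q k k"
  have sym: "Q i k = Q k i" if "i \<in> I" for i
    using insert.prems(1)[of i k] that by simp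
  have expand: "0 \<le> d * (x k)\<^sup>2 + 2 * x k * (\<Sum>i\<in>I. Q k i * x i)
      + (\<Sum>i\<in>I. \<Sum>j\<in>I. x i * Q i j * x j)" for x
    using insert.prems(2)[of x] quadratic_form_insert[OF insert.hyps(1,2), of Q x] sym
    by (simp add: d_def)
  have fresh: "(\<Sum>i\<in>I. Q k i * (x(k := c)) i) = (\<Sum>i\<in>I. Q k i * x i)"
    "(\<Sum>i\<in>I. \<Sum>j\<in>I. (x(k := c)) i * Q i j * (x(k := c)) j) = (\<Sum>i\<in>I. \<Sum>j\<in>I. x i * Q i j * x j)"
    for x c
    using insert.hyps(2) by (auto intro!: sum.cong)
  have expand': "0 \<le> d * c\<^sup>2 + 2 * c * (\<Sum>i\<in>I. Q k i * x i)
      + (\<Sum>i\<in>I. \<Sum>j\<in>I. x i * Q i j * x j)" for x c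
    using expand[of "x(k := c)"] unfolding fresh by simp
  have d: "d \<ge> 0" using expand'[of 1 "\<lambda>_. 0"] by simp
  have row0: "Q k i = 0" if "d = 0" "i \<in> I" for i
  proof (rule ccontr)
    assume "Q k i \<noteq> 0"
    define e :: "'a \<Rightarrow> real" where "e l = (if l = i then 1 else 0)" for l
    have "(\<Sum>l\<in>I. Q k l * e l) = Q k i" "(\<Sum>l\<in>I. \<Sum>j\<in>I. e l * Q l j * e j) = Q i i"
      using \<open>i \<in> I\<close> insert.hyps(1)
      by (simp_all add: e_def if_distrib[where f = "\<lambda>z. _ * z"]
          if_distrib[where f = "\<lambda>z. z * _"] sum.If_cases cong: if_cong)
    then have "0 \<le> 2 * c * Q k i + Q i i" for c
      using expand'[of c e] \<open>d = 0\<close> by simp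
    \<comment> \<open>An affine function of \<open>c\<close> with nonzero slope takes the value \<open>-1\<close> somewhere.\<close>
    from this[of "- (Q i i + 1) / (2 * Q k i)"] \<open>Q k i \<noteq> 0\<close> show False
      by (simp add: field_simps)
  qed
  define Q' where "Q' i j = Q i j - Q k i * Q k j / d" for i j
  have "(\<Sum>i\<in>I. \<Sum>j\<in>I. x i * Q' i j * x j) \<ge> 0" for x
  proof -
    define l where "l = (\<Sum>i\<in>I. Q k i * x i)"
    have "l * l = (\<Sum>i\<in>I. \<Sum>j\<in>I. (Q k i * x i) * (Q k j * x j))"
      by (simp add: l_def sum_product)
    then have "(\<Sum>i\<in>I. \<Sum>j\<in>I. x i * Q' i j * x j)
        = (\<Sum>i\<in>I. \<Sum>j\<in>I. x i * Q i j * x j) - l * l / d"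
      by (simp add: Q'_def sum_subtractf sum_divide_distrib algebra_simps)
    moreover have "d * (- l / d)\<^sup>2 + 2 * (- l / d) * l = - (l * l / d)"
      by (cases "d = 0") (simp_all add: power2_eq_square field_simps)
    \<comment> \<open>The coordinate \<open>- l / d\<close> at \<open>k\<close> minimises the form \<open>Q\<close> for the given \<open>x\<close>.\<close>
    ultimately show ?thesis using expand'[of "- l / d" x] by (simp add: l_def)
  qed
  moreover have "Q' i j = Q' j i" if "i \<in> I" "j \<in> I" for i j
    using insert.prems(1)[of i j] that by (simp add: Q'_def)
  ultimately obtain us where us: "\<And>i j. i \<in> I \<Longrightarrow> j \<in> I \<Longrightarrow> Q' i j = (\<Sum>u\<leftarrow>us. u i * u j)"
    using insert.IH[of Q'] by blast
  define w where "w i = Q k i / sqrt d" for i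
  have w: "w i * w j = Q k i * Q k j / d" for i j
    using d by (simp add: w_def)
  define vs where "vs = w # map (\<lambda>u. u(k := 0)) us"
  have vs: "(\<Sum>u\<leftarrow>vs. u i * u j)
      = w i * w j + (if i = k \<or> j = k then 0 else \<Sum>u\<leftarrow>us. u i * u j)" for i j
    by (auto simp: vs_def o_def)
  have "Q i j = (\<Sum>u\<leftarrow>vs. u i * u j)" if ij: "i \<in> insert k I" "j \<in> insert k I" for i j
  proof -
    consider "i = k" "j = k" | "i = k" "j \<in> I" | "j = k" "i \<in> I" | "i \<in> I" "j \<in> I"
      using ij by blast
    then show ?thesis
    proof cases
      case 4
      then show ?thesis using us[OF 4] insert.hyps(2) vs w by (auto simp: Q'_def)
    qed (use row0 sym in \<open>auto simp: vs w d_def\<close>)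
  qed
  then show ?case by blast
qed

section \<open>Evaluation of polynomials\<close>

definition monomial_value :: "(nat \<Rightarrow> real) \<Rightarrow> monomial \<Rightarrow> real" where
  "monomial_value x m = (\<Prod>k\<in>Poly_Mapping.keys m. x k ^ Poly_Mapping.lookup m k)"

lemma monomial_value_superset:
  assumes "finite K" "Poly_Mapping.keys m \<subseteq> K"
  shows "monomial_value x m = (\<Prod>k\<in>K. x k ^ Poly_Mapping.lookup m k)"
  unfolding monomial_value_def
  by (rule prod.mono_neutral_left) (use assms in \<open>auto simp: in_keys_iff\<close>)

lemma monomial_value_add:
  "monomial_value x (m + m') = monomial_value x m * monomial_value x m'"
proof -
  let ?K = "Poly_Mapping.keys m \<union> Poly_Mapping.keys m'"
  show ?thesis
    using keys_add[of m m']
    by (simp add: monomial_value_superset[of ?K] lookup_add power_add prod.distrib)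
qed

lemma monomial_value_indicator:
  "monomial_value (indicator S) m = (if Poly_Mapping.keys m \<subseteq> S then 1 else 0)"
proof (cases "Poly_Mapping.keys m \<subseteq> S")
  case True
  then show ?thesis
    unfolding monomial_value_def by (auto intro!: prod.neutral simp: indicator_def)
next
  case False
  then obtain k where "k \<in> Poly_Mapping.keys m" "k \<notin> S" by blast
  then have "monomial_value (indicator S) m = 0"
    unfolding monomial_value_def by (intro prod_zero) (auto simp: indicator_def in_keys_iff)
  with False show ?thesis by simp
qed

lemma mpoly_eq_sum_terms:
  fixes p :: mpoly
  shows "p = (\<Sum>m\<in>Poly_Mapping.keys p. Poly_Mapping.single m (Poly_Mapping.lookup p m))"
  by (rule poly_mapping_eqI)
     (simp add: lookup_sum lookup_single when_def sum.delta' sum.delta in_keys_iff)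

lemma eval_mpoly_superset:
  assumes "finite K" "Poly_Mapping.keys p \<subseteq> K"
  shows "eval_mpoly p x = (\<Sum>m\<in>K. Poly_Mapping.lookup p m * monomial_value x m)"
  unfolding eval_mpoly_def monomial_value_def
  by (rule sum.mono_neutral_left) (use assms in \<open>auto simp: in_keys_iff\<close>)

lemma eval_mpoly_add: "eval_mpoly (p + q) x = eval_mpoly p x + eval_mpoly q x"
proof -
  let ?K = "Poly_Mapping.keys p \<union> Poly_Mapping.keys q"
  show ?thesis
    using keys_add[of p q]
    by (simp add: eval_mpoly_superset[of ?K] lookup_add sum.distrib distrib_right)
qed

lemma eval_mpoly_zero: "eval_mpoly 0 x = 0"
  by (simp add: eval_mpoly_def)

lemma eval_mpoly_uminus: "eval_mpoly (- p) x = - eval_mpoly p x"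
  by (simp add: eval_mpoly_def sum_negf)

lemma eval_mpoly_diff: "eval_mpoly (p - q) x = eval_mpoly p x - eval_mpoly q x"
  using eval_mpoly_add[of p "- q"] by (simp add: eval_mpoly_uminus)

lemma eval_mpoly_sum: "eval_mpoly (\<Sum>a\<in>A. p a) x = (\<Sum>a\<in>A. eval_mpoly (p a) x)"
  by (induction A rule: infinite_finite_induct) (simp_all add: eval_mpoly_zero eval_mpoly_add)

lemma eval_mpoly_sum_list: "eval_mpoly (\<Sum>a\<leftarrow>as. p a) x = (\<Sum>a\<leftarrow>as. eval_mpoly (p a) x)"
  by (induction as) (simp_all add: eval_mpoly_zero eval_mpoly_add)

lemma eval_mpoly_single: "eval_mpoly (Poly_Mapping.single m c) x = c * monomial_value x m"
  by (simp add: eval_mpoly_superset[of "{m}"])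

lemma eval_mpoly_mult: "eval_mpoly (p * q) x = eval_mpoly p x * eval_mpoly q x"
proof -
  have terms: "eval_mpoly r x
      = (\<Sum>m\<in>Poly_Mapping.keys r. Poly_Mapping.lookup r m * monomial_value x m)" for r
    by (simp add: eval_mpoly_def monomial_value_def)
  have "p * q = (\<Sum>m\<in>Poly_Mapping.keys p. \<Sum>m'\<in>Poly_Mapping.keys q.
      Poly_Mapping.single (m + m') (Poly_Mapping.lookup p m * Poly_Mapping.lookup q m'))"
    by (subst mpoly_eq_sum_terms[of p], subst mpoly_eq_sum_terms[of q])
       (simp add: sum_product mult_single)
  then have "eval_mpoly (p * q) x = (\<Sum>m\<in>Poly_Mapping.keys p. \<Sum>m'\<in>Poly_Mapping.keys q.
      (Poly_Mapping.lookup p m * monomial_value x m)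
      * (Poly_Mapping.lookup q m' * monomial_value x m'))"
    by (simp add: eval_mpoly_sum eval_mpoly_single monomial_value_add algebra_simps)
  then show ?thesis by (simp add: terms sum_product)
qed

section \<open>Boolean polynomials modulo the ideal of the cube\<close>

lemma polys_in_single: "Poly_Mapping.keys m \<subseteq> V \<Longrightarrow> Poly_Mapping.single m c \<in> polys_in V"
  by (auto simp: polys_in_def)

lemma polys_in_zero: "0 \<in> polys_in V"
  by (simp add: polys_in_def)

lemma polys_in_add: "p \<in> polys_in V \<Longrightarrow> q \<in> polys_in V \<Longrightarrow> p + q \<in> polys_in V"
  using keys_add[of p q] by (auto simp: polys_in_def)

lemma polys_in_uminus: "p \<in> polys_in V \<Longrightarrow> - p \<in> polys_in V"
  by (simp add: polys_in_def)

lemma polys_in_diff: "p \<in> polys_in V \<Longrightarrow> q \<in> polys_in V \<Longrightarrow> p - q \<in> polys_in V"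
  using polys_in_add[of p V "- q"] by (simp add: polys_in_uminus)

lemma polys_in_mult:
  assumes "p \<in> polys_in V" "q \<in> polys_in V"
  shows "p * q \<in> polys_in V"
  unfolding polys_in_def
proof (intro CollectI ballI)
  fix m assume "m \<in> Poly_Mapping.keys (p * q)"
  then obtain a b where "m = a + b" "a \<in> Poly_Mapping.keys p" "b \<in> Poly_Mapping.keys q"
    using keys_mult[of p q] by blast
  then show "Poly_Mapping.keys m \<subseteq> V"
    using assms keys_add[of a b] by (fastforce simp: polys_in_def)
qed

lemma polys_in_sum: "(\<And>a. a \<in> A \<Longrightarrow> p a \<in> polys_in V) \<Longrightarrow> (\<Sum>a\<in>A. p a) \<in> polys_in V"
  by (induction A rule: infinite_finite_induct) (simp_all add: polys_in_zero polys_in_add)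

lemma polys_in_sum_list:
  "(\<And>a. a \<in> set as \<Longrightarrow> p a \<in> polys_in V) \<Longrightarrow> (\<Sum>a\<leftarrow>as. p a) \<in> polys_in V"
  by (induction as) (simp_all add: polys_in_zero polys_in_add)

lemma ideal_in_zero: "0 \<in> ideal_in R G"
  unfolding ideal_in_def by (intro CollectI exI[of _ "{}"]) simp

lemma ideal_in_generator_multiple:
  assumes "g \<in> G" "r \<in> R"
  shows "r * g \<in> ideal_in R G"
  unfolding ideal_in_def using assms by (intro CollectI exI[of _ "{g}"] exI[of _ "\<lambda>_. r"]) simp

lemma ideal_in_add:
  assumes "p \<in> ideal_in (polys_in V) G" "q \<in> ideal_in (polys_in V) G"
  shows "p + q \<in> ideal_in (polys_in V) G"
proof -
  obtain A h where A: "finite A" "A \<subseteq> G" "\<forall>g\<in>A. h g \<in> polys_in V" "p = (\<Sum>g\<in>A. h g * g)"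
    using assms(1) unfolding ideal_in_def by blast
  obtain B k where B: "finite B" "B \<subseteq> G" "\<forall>g\<in>B. k g \<in> polys_in V" "q = (\<Sum>g\<in>B. k g * g)"
    using assms(2) unfolding ideal_in_def by blast
  define h' where "h' g = (if g \<in> A then h g else 0)" for g
  define k' where "k' g = (if g \<in> B then k g else 0)" for g
  have "p = (\<Sum>g\<in>A \<union> B. h' g * g)" "q = (\<Sum>g\<in>A \<union> B. k' g * g)"
    unfolding A(4) B(4) h'_def k'_def
    by (rule sum.mono_neutral_cong_left; use A(1) B(1) in auto)+
  then have "p + q = (\<Sum>g\<in>A \<union> B. (h' g + k' g) * g)"
    by (simp add: sum.distrib distrib_right)
  moreover have "\<forall>g\<in>A \<union> B. h' g + k' g \<in> polys_in V"
    using A(3) B(3) by (auto simp: h'_def k'_def intro: polys_in_add polys_in_zero)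
  ultimately show ?thesis
    unfolding ideal_in_def using A(1,2) B(1,2)
    by (intro CollectI exI[of _ "A \<union> B"] exI[of _ "\<lambda>g. h' g + k' g"]) simp
qed

lemma ideal_in_sum:
  "(\<And>a. a \<in> A \<Longrightarrow> p a \<in> ideal_in (polys_in V) G) \<Longrightarrow> (\<Sum>a\<in>A. p a) \<in> ideal_in (polys_in V) G"
  by (induction A rule: infinite_finite_induct) (simp_all add: ideal_in_zero ideal_in_add)

lemma monomial_degree_superset:
  assumes "finite K" "Poly_Mapping.keys m \<subseteq> K"
  shows "monomial_degree m = (\<Sum>k\<in>K. Poly_Mapping.lookup m k)"
  unfolding monomial_degree_def
  by (rule sum.mono_neutral_left) (use assms in \<open>auto simp: in_keys_iff\<close>)

lemma monomial_degree_add: "monomial_degree (m + m') = monomial_degree m + monomial_degree m'"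
proof -
  let ?K = "Poly_Mapping.keys m \<union> Poly_Mapping.keys m'"
  show ?thesis
    using keys_add[of m m']
    by (simp add: monomial_degree_superset[of ?K] lookup_add sum.distrib)
qed

text \<open>As long as some exponent is at least 2, it can be lowered by one: for \<open>m = m\<^sub>0 + 2 e\<^sub>k\<close> the
  difference of the monomials \<open>m\<close> and \<open>m\<^sub>0 + e\<^sub>k\<close> is a multiple of \<open>x\<^sub>k\<^sup>2 - x\<^sub>k\<close>. This keeps the set of
  variables that occur and ends at the squarefree monomial.\<close>

lemma monomial_minus_sqfree_in_boolean_ideal:
  assumes "Poly_Mapping.keys m \<subseteq> V"
  shows "Poly_Mapping.single m c - Poly_Mapping.single (sqfree_monomial (Poly_Mapping.keys m)) c
    \<in> boolean_ideal V"
  using assms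
proof (induction "monomial_degree m" arbitrary: m rule: less_induct)
  case less
  show ?case
  proof (cases "\<exists>k. Poly_Mapping.lookup m k \<ge> 2")
    case False
    have "Poly_Mapping.lookup m k \<le> 1" for k
    proof -
      have "\<not> 2 \<le> Poly_Mapping.lookup m k" using False by blast
      then show ?thesis by linarith
    qed
    then have "multilinear (Poly_Mapping.single m 1)" by (simp add: multilinear_def)
    then have m: "m = sqfree_monomial (Poly_Mapping.keys m)"
      by (rule multilinear_key_eq) simp
    show ?thesis unfolding m[symmetric] by (simp add: boolean_ideal_def ideal_in_zero)
  next
    case True
    then obtain k where k: "Poly_Mapping.lookup m k \<ge> 2" by blast
    define e :: monomial where "e = Poly_Mapping.single k 1"
    define m0 where "m0 = m - (e + e)"
    have m: "m = m0 + (e + e)"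
      using k unfolding m0_def e_def
      by (intro poly_mapping_eqI) (auto simp: lookup_add lookup_minus lookup_single when_def)
    have keys: "Poly_Mapping.keys (m0 + e) = Poly_Mapping.keys m"
      by (auto simp: m e_def in_keys_iff lookup_add lookup_single when_def split: if_splits)
    have "monomial_degree e = 1" by (simp add: e_def monomial_degree_def)
    then have "monomial_degree (m0 + e) < monomial_degree m"
      by (simp add: m monomial_degree_add)
    from less.hyps[OF this] have IH: "Poly_Mapping.single (m0 + e) c
        - Poly_Mapping.single (sqfree_monomial (Poly_Mapping.keys m)) c \<in> boolean_ideal V"
      using less.prems keys by simp
    have "k \<in> V" using k less.prems by (force simp: in_keys_iff)
    moreover have "Poly_Mapping.keys m0 \<subseteq> V"
      using less.prems by (force simp: m in_keys_iff lookup_add)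
    ultimately have "Poly_Mapping.single m0 c * (mvar k ^ 2 - mvar k) \<in> boolean_ideal V"
      unfolding boolean_ideal_def
      by (intro ideal_in_generator_multiple polys_in_single) auto
    moreover have "Poly_Mapping.single m0 c * (mvar k ^ 2 - mvar k)
        = Poly_Mapping.single m c - Poly_Mapping.single (m0 + e) c"
      by (simp add: m mvar_def e_def power2_eq_square mult_single right_diff_distrib)
    ultimately have "Poly_Mapping.single m c - Poly_Mapping.single (m0 + e) c \<in> boolean_ideal V"
      by simp
    from ideal_in_add[OF this[unfolded boolean_ideal_def] IH[unfolded boolean_ideal_def]]
    show ?thesis by (simp add: boolean_ideal_def)
  qed
qed

text \<open>The value at \<open>1\<^sub>S\<close> is the sum of the coefficients over the subsets of \<open>S\<close>, so the coefficients
  vanish one after the other, from small sets to large ones.\<close>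

lemma multilinear_vanishing_on_cube:
  assumes V: "finite V" and p: "multilinear p" "p \<in> polys_in V"
    and vanish: "\<And>S. S \<subseteq> V \<Longrightarrow> eval_mpoly p (indicator S) = 0"
  shows "p = 0"
proof -
  have coeff: "Poly_Mapping.lookup p (sqfree_monomial S) = 0" if "S \<subseteq> V" for S
    using finite_subset[OF that V] that
  proof (induction S rule: finite_psubset_induct)
    case (psubset S)
    have "0 = (\<Sum>T\<in>Pow S. Poly_Mapping.lookup p (sqfree_monomial T))"
      using vanish[OF psubset.prems] eval_multilinear_indicator[OF p V psubset.prems] by simp
    also have "\<dots> = (\<Sum>T\<in>{S}. Poly_Mapping.lookup p (sqfree_monomial T))"
      by (rule sum.mono_neutral_right) (use psubset in auto)
    finally show ?case by simp
  qed
  have "m \<notin> Poly_Mapping.keys p" for m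
  proof
    assume m: "m \<in> Poly_Mapping.keys p"
    then obtain S where "S \<subseteq> V" "m = sqfree_monomial S" using multilinear_keys_subset[OF p] by blast
    with m coeff[of S] show False by (simp add: in_keys_iff)
  qed
  then show ?thesis by (metis keys_eq_empty all_not_in_conv)
qed

text \<open>One direction is clear, since the generators vanish at 0/1 points. For the other, \<open>p\<close> is
  congruent to its multilinear reduction, which has the same values on the cube as \<open>p\<close> and is
  therefore zero.\<close>

lemma boolean_ideal_iff_vanishes_on_cube:
  assumes V: "finite V" and p: "p \<in> polys_in V"
  shows "p \<in> boolean_ideal V \<longleftrightarrow> (\<forall>S\<subseteq>V. eval_mpoly p (indicator S) = 0)"
proof
  assume "p \<in> boolean_ideal V"
  then obtain A h where A: "A \<subseteq> {mvar k ^ 2 - mvar k | k. k \<in> V}" "p = (\<Sum>g\<in>A. h g * g)"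
    unfolding boolean_ideal_def ideal_in_def by blast
  have "eval_mpoly (mvar k ^ 2 - mvar k) (indicator S) = 0" for k S
    by (simp add: eval_mpoly_diff power2_eq_square eval_mpoly_mult mvar_def eval_mpoly_single
        monomial_value_indicator)
  then show "\<forall>S\<subseteq>V. eval_mpoly p (indicator S) = 0"
    using A(1) by (auto simp: A(2) eval_mpoly_sum eval_mpoly_mult intro!: sum.neutral)
next
  assume vanish: "\<forall>S\<subseteq>V. eval_mpoly p (indicator S) = 0"
  let ?sq = "\<lambda>m. sqfree_monomial (Poly_Mapping.keys m)"
  define r where
    "r = (\<Sum>m\<in>Poly_Mapping.keys p. Poly_Mapping.single (?sq m) (Poly_Mapping.lookup p m))"
  have "p - r \<in> boolean_ideal V"
  proof -
    have "p - r = (\<Sum>m\<in>Poly_Mapping.keys p. Poly_Mapping.single m (Poly_Mapping.lookup p m)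
        - Poly_Mapping.single (?sq m) (Poly_Mapping.lookup p m))"
      unfolding r_def sum_subtractf using mpoly_eq_sum_terms[of p] by simp
    also have "\<dots> \<in> boolean_ideal V"
      unfolding boolean_ideal_def
      by (intro ideal_in_sum monomial_minus_sqfree_in_boolean_ideal[unfolded boolean_ideal_def])
         (use p in \<open>auto simp: polys_in_def\<close>)
    finally show ?thesis .
  qed
  moreover have "r = 0"
  proof (rule multilinear_vanishing_on_cube[OF V])
    have "Poly_Mapping.keys r \<subseteq> ?sq ` Poly_Mapping.keys p"
      unfolding r_def using keys_sum by (rule order_trans) auto
    then show "multilinear r"
      by (auto simp: multilinear_def lookup_sqfree_monomial dest!: subsetD)
    show "r \<in> polys_in V"
      unfolding r_def
      by (intro polys_in_sum polys_in_single)
         (use p in \<open>auto simp: polys_in_def keys_sqfree_monomial\<close>)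
    fix S assume "S \<subseteq> V"
    have "eval_mpoly r (indicator S) = eval_mpoly p (indicator S)"
      unfolding r_def eval_mpoly_sum eval_mpoly_single
      by (subst (2) mpoly_eq_sum_terms)
         (simp add: eval_mpoly_sum eval_mpoly_single monomial_value_indicator keys_sqfree_monomial)
    then show "eval_mpoly r (indicator S) = 0" using vanish \<open>S \<subseteq> V\<close> by simp
  qed
  ultimately show "p \<in> boolean_ideal V" by simp
qed

section \<open>Second partial derivatives of multilinear polynomials\<close>

lemma lookup_partial_deriv:
  "Poly_Mapping.lookup (partial_deriv i p) m
    = (of_nat (Poly_Mapping.lookup m i) + 1) * Poly_Mapping.lookup p (m + Poly_Mapping.single i 1)"
proof -
  let ?e = "Poly_Mapping.single i 1 :: monomial"
  have eq_iff: "m' - ?e = m \<longleftrightarrow> m' = m + ?e" if pos: "Poly_Mapping.lookup m' i \<noteq> 0" for m' :: monomial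
  proof
    assume "m' - ?e = m"
    moreover have "m' = (m' - ?e) + ?e"
      using pos by (intro poly_mapping_eqI)
        (auto simp: lookup_add lookup_minus lookup_single when_def)
    ultimately show "m' = m + ?e" by simp
  qed simp
  have "Poly_Mapping.lookup (partial_deriv i p) m = (\<Sum>m'\<in>Poly_Mapping.keys p.
      (of_nat (Poly_Mapping.lookup m' i) * Poly_Mapping.lookup p m' when m' - ?e = m))"
    by (simp add: partial_deriv_def lookup_sum lookup_single)
  also have "\<dots> = (\<Sum>m'\<in>Poly_Mapping.keys p. if m' = m + ?e
      then of_nat (Poly_Mapping.lookup m' i) * Poly_Mapping.lookup p m' else 0)"
  proof (rule sum.cong[OF refl])
    fix m'
    show "(of_nat (Poly_Mapping.lookup m' i) * Poly_Mapping.lookup p m' when m' - ?e = m)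
        = (if m' = m + ?e then of_nat (Poly_Mapping.lookup m' i) * Poly_Mapping.lookup p m' else 0)"
      using eq_iff[of m'] by (cases "Poly_Mapping.lookup m' i = 0") (auto simp: when_def)
  qed
  also have "\<dots> = of_nat (Poly_Mapping.lookup (m + ?e) i) * Poly_Mapping.lookup p (m + ?e)"
    by (simp add: in_keys_iff)
  finally show ?thesis by (simp add: lookup_add)
qed

lemma partial_deriv_commute:
  "partial_deriv i (partial_deriv j p) = partial_deriv j (partial_deriv i p)"
  by (rule poly_mapping_eqI)
     (auto simp: lookup_partial_deriv lookup_add lookup_single when_def add_ac)

lemma multilinear_second_partial:
  assumes F: "multilinear F" "F \<in> polys_in W" and ij: "i \<noteq> j"
  shows "multilinear (partial_deriv i (partial_deriv j F))"
    and "partial_deriv i (partial_deriv j F) \<in> polys_in (W - {i, j})"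
proof -
  let ?D = "partial_deriv i (partial_deriv j F)"
  let ?e = "Poly_Mapping.single i 1 + Poly_Mapping.single j 1 :: monomial"
  have key: "m + ?e \<in> Poly_Mapping.keys F" if "m \<in> Poly_Mapping.keys ?D" for m
    using that by (simp add: in_keys_iff lookup_partial_deriv add.assoc)
  have le: "Poly_Mapping.lookup m k + Poly_Mapping.lookup ?e k \<le> 1"
    if "m \<in> Poly_Mapping.keys ?D" for m k
    using key[OF that] F(1) by (metis lookup_add multilinear_def)
  show "multilinear ?D"
    unfolding multilinear_def using le by (meson add_leD1)
  show "?D \<in> polys_in (W - {i, j})"
    unfolding polys_in_def
  proof (intro CollectI ballI subsetI)
    fix m k assume m: "m \<in> Poly_Mapping.keys ?D" and k: "k \<in> Poly_Mapping.keys m"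
    have "k \<noteq> i" "k \<noteq> j"
      using le[OF m, of k] k by (auto simp: in_keys_iff lookup_add lookup_single)
    moreover have "k \<in> Poly_Mapping.keys (m + ?e)"
      using k by (simp add: in_keys_iff lookup_add)
    then have "k \<in> W" using key[OF m] F(2) by (auto simp: polys_in_def)
    ultimately show "k \<in> W - {i, j}" by simp
  qed
qed

lemma sqfree_monomial_insert:
  "finite S \<Longrightarrow> k \<notin> S \<Longrightarrow> sqfree_monomial (insert k S) = Poly_Mapping.single k 1 + sqfree_monomial S"
  by (simp add: sqfree_monomial_def)

lemma eval_second_partial_indicator:
  assumes F: "multilinear F" "F \<in> polys_in W" and W: "finite W" and ij: "i \<noteq> j"
    and S: "S \<subseteq> W - {i, j}"
  shows "eval_mpoly (partial_deriv i (partial_deriv j F)) (indicator S)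
    = (\<Sum>T\<in>Pow S. Poly_Mapping.lookup F (sqfree_monomial (insert i (insert j T))))"
proof -
  have "Poly_Mapping.lookup (partial_deriv i (partial_deriv j F)) (sqfree_monomial T)
      = Poly_Mapping.lookup F (sqfree_monomial (insert i (insert j T)))" if "T \<subseteq> S" for T
  proof -
    have T: "finite T" "i \<notin> T" "j \<notin> T" using that S W finite_subset[of T W] by auto
    then have "sqfree_monomial (insert i (insert j T))
        = sqfree_monomial T + Poly_Mapping.single i 1 + Poly_Mapping.single j 1"
      using ij by (simp add: sqfree_monomial_insert add_ac)
    then show ?thesis
      using T ij by (simp add: lookup_partial_deriv lookup_add lookup_sqfree_monomial lookup_single)
  qed
  then show ?thesis
    using eval_multilinear_indicator[OF multilinear_second_partial[OF F ij] _ S] W by simp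
qed

section \<open>Sums of squares on the cube\<close>

lemma total_degree_le_iff:
  "total_degree q \<le> t \<longleftrightarrow> (\<forall>m\<in>Poly_Mapping.keys q. monomial_degree m \<le> t)"
  by (simp add: total_degree_def)

lemma card_keys_le_monomial_degree: "card (Poly_Mapping.keys m) \<le> monomial_degree m"
proof -
  have "(\<Sum>k\<in>Poly_Mapping.keys m. 1) \<le> (\<Sum>k\<in>Poly_Mapping.keys m. Poly_Mapping.lookup m k)"
    by (rule sum_mono) (simp add: in_keys_iff Suc_le_eq)
  then show ?thesis by (simp add: monomial_degree_def)
qed

lemma monomial_degree_sqfree: "finite B \<Longrightarrow> monomial_degree (sqfree_monomial B) = card B"
  by (simp add: monomial_degree_def keys_sqfree_monomial lookup_sqfree_monomial)

definition small_subsets :: "nat \<Rightarrow> 'a set \<Rightarrow> 'a set set" where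
  "small_subsets t V = {B. B \<subseteq> V \<and> card B \<le> t}"

lemma finite_small_subsets: "finite V \<Longrightarrow> finite (small_subsets t V)"
  by (rule finite_subset[of _ "Pow V"]) (auto simp: small_subsets_def)

lemma card_small_subsets:
  assumes "finite V"
  shows "card (small_subsets t V) = (\<Sum>k=0..t. card V choose k)"
proof -
  have "small_subsets t V = (\<Union>k\<in>{0..t}. {B. B \<subseteq> V \<and> card B = k})"
    by (auto simp: small_subsets_def)
  also have "card \<dots> = (\<Sum>k=0..t. card {B. B \<subseteq> V \<and> card B = k})"
    by (rule card_UN_disjoint) (use assms in auto)
  finally show ?thesis using assms by (simp add: n_subsets)
qed

text \<open>At a 0/1 point a monomial only depends on the set of its variables, which has at most \<open>t\<close>
  elements if the degree is at most \<open>t\<close>; so the terms of \<open>q\<close> can be collected by variable sets.\<close>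

lemma eval_low_degree_indicator:
  assumes V: "finite V" and q: "q \<in> polys_in V" "total_degree q \<le> t"
  shows "eval_mpoly q (indicator S) = (\<Sum>B\<in>small_subsets t V.
    of_bool (B \<subseteq> S) * (\<Sum>m\<in>{m \<in> Poly_Mapping.keys q. Poly_Mapping.keys m = B}. Poly_Mapping.lookup q m))"
proof -
  have "Poly_Mapping.keys ` Poly_Mapping.keys q \<subseteq> small_subsets t V"
  proof
    fix B assume "B \<in> Poly_Mapping.keys ` Poly_Mapping.keys q"
    then obtain m where m: "m \<in> Poly_Mapping.keys q" "B = Poly_Mapping.keys m" by blast
    have "card B \<le> t"
      using m q(2) card_keys_le_monomial_degree[of m]
      by (metis order_trans total_degree_le_iff)
    then show "B \<in> small_subsets t V" using m q(1) by (auto simp: polys_in_def small_subsets_def)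
  qed
  from sum.group[OF finite_keys finite_small_subsets[OF V] this,
      of "\<lambda>m. Poly_Mapping.lookup q m * monomial_value (indicator S) m"]
  have "eval_mpoly q (indicator S) = (\<Sum>B\<in>small_subsets t V.
      \<Sum>m\<in>{m \<in> Poly_Mapping.keys q. Poly_Mapping.keys m = B}.
        Poly_Mapping.lookup q m * monomial_value (indicator S) m)"
    by (simp add: eval_mpoly_superset[of "Poly_Mapping.keys q"])
  also have "\<dots> = (\<Sum>B\<in>small_subsets t V. of_bool (B \<subseteq> S) *
      (\<Sum>m\<in>{m \<in> Poly_Mapping.keys q. Poly_Mapping.keys m = B}. Poly_Mapping.lookup q m))"
    unfolding sum_distrib_left
    by (rule sum.cong[OF refl], rule sum.cong[OF refl]) (auto simp: monomial_value_indicator)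
  finally show ?thesis .
qed

text \<open>A polynomial of degree at most \<open>t\<close> is replaced by the vector \<open>u\<close> of its collected coefficients,
  indexed by positions in an enumeration \<open>Bs\<close> of the small subsets, since matrix indices are numbers.
  Conversely, \<open>u\<close> is the coefficient vector of a multilinear polynomial of degree at most \<open>t\<close>.\<close>

lemma sos_modulo_iff_squares_on_cube:
  assumes V: "finite V" and p: "p \<in> polys_in V"
    and Bs: "distinct Bs" "set Bs = small_subsets t V"
  shows "sos_modulo t V (boolean_ideal V) p \<longleftrightarrow>
    (\<exists>us :: (nat \<Rightarrow> real) list. \<forall>S\<subseteq>V. eval_mpoly p (indicator S)
       = (\<Sum>u\<leftarrow>us. (\<Sum>a<length Bs. of_bool (Bs ! a \<subseteq> S) * u a)\<^sup>2))"
proof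
  have reindex: "(\<Sum>B\<in>small_subsets t V. g B) = (\<Sum>a<length Bs. g (Bs ! a))" for g :: "nat set \<Rightarrow> real"
    unfolding Bs(2)[symmetric]
    by (rule sum.reindex_bij_betw[symmetric, OF bij_betw_nth[OF Bs(1)]]) auto
  assume "sos_modulo t V (boolean_ideal V) p"
  then obtain qs where qs: "\<And>q. q \<in> set qs \<Longrightarrow> q \<in> polys_in V \<and> total_degree q \<le> t"
    and ideal: "p - (\<Sum>q\<leftarrow>qs. q ^ 2) \<in> boolean_ideal V"
    unfolding sos_modulo_def by blast
  have "p - (\<Sum>q\<leftarrow>qs. q * q) \<in> polys_in V"
    by (rule polys_in_diff[OF p], rule polys_in_sum_list, rule polys_in_mult) (simp_all only: qs)
  then have vanish: "\<forall>S\<subseteq>V. eval_mpoly (p - (\<Sum>q\<leftarrow>qs. q * q)) (indicator S) = 0"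
    using ideal[unfolded power2_eq_square] by (simp only: boolean_ideal_iff_vanishes_on_cube[OF V])
  have eval: "eval_mpoly p (indicator S) = (\<Sum>q\<leftarrow>qs. (eval_mpoly q (indicator S))\<^sup>2)"
    if "S \<subseteq> V" for S
    using vanish[rule_format, OF that]
    by (simp add: eval_mpoly_diff eval_mpoly_sum_list eval_mpoly_mult power2_eq_square)
  define u :: "mpoly \<Rightarrow> nat \<Rightarrow> real" where "u q a =
    (\<Sum>m\<in>{m \<in> Poly_Mapping.keys q. Poly_Mapping.keys m = Bs ! a}. Poly_Mapping.lookup q m)" for q a
  have eval_q: "eval_mpoly q (indicator S) = (\<Sum>a<length Bs. of_bool (Bs ! a \<subseteq> S) * u q a)"
    if "q \<in> set qs" for q S
    using qs[OF that] eval_low_degree_indicator[OF V, of q t S] by (simp only: reindex u_def)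
  have squares: "eval_mpoly p (indicator S)
      = (\<Sum>u\<leftarrow>map u qs. (\<Sum>a<length Bs. of_bool (Bs ! a \<subseteq> S) * u a)\<^sup>2)" if "S \<subseteq> V" for S
    unfolding eval[OF that] list.map_comp o_def
    by (rule arg_cong[where f = sum_list], rule map_cong[OF refl]) (simp only: eval_q)
  show "\<exists>us :: (nat \<Rightarrow> real) list. \<forall>S\<subseteq>V. eval_mpoly p (indicator S)
       = (\<Sum>u\<leftarrow>us. (\<Sum>a<length Bs. of_bool (Bs ! a \<subseteq> S) * u a)\<^sup>2)"
    by (rule exI[of _ "map u qs"], intro allI impI, rule squares)
next
  assume "\<exists>us :: (nat \<Rightarrow> real) list. \<forall>S\<subseteq>V. eval_mpoly p (indicator S)
       = (\<Sum>u\<leftarrow>us. (\<Sum>a<length Bs. of_bool (Bs ! a \<subseteq> S) * u a)\<^sup>2)"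
  then obtain us :: "(nat \<Rightarrow> real) list" where us: "\<forall>S\<subseteq>V. eval_mpoly p (indicator S)
       = (\<Sum>u\<leftarrow>us. (\<Sum>a<length Bs. of_bool (Bs ! a \<subseteq> S) * u a)\<^sup>2)" ..
  define q :: "(nat \<Rightarrow> real) \<Rightarrow> mpoly" where
    "q u = (\<Sum>a<length Bs. Poly_Mapping.single (sqfree_monomial (Bs ! a)) (u a))" for u
  have B: "Bs ! a \<subseteq> V" "card (Bs ! a) \<le> t" "finite (Bs ! a)" if "a < length Bs" for a
  proof -
    have "Bs ! a \<in> small_subsets t V" using nth_mem[OF that] by (simp only: Bs(2))
    then show "Bs ! a \<subseteq> V" "card (Bs ! a) \<le> t" by (simp_all add: small_subsets_def)
    with V show "finite (Bs ! a)" by (metis finite_subset)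
  qed
  have q_in: "q u \<in> polys_in V" for u
    unfolding q_def by (intro polys_in_sum polys_in_single) (simp add: keys_sqfree_monomial B)
  have q_keys: "Poly_Mapping.keys (q u) \<subseteq> (\<lambda>a. sqfree_monomial (Bs ! a)) ` {..<length Bs}" for u
    unfolding q_def using keys_sum by (rule order_trans) (auto split: if_splits)
  have q_deg: "total_degree (q u) \<le> t" for u
    unfolding total_degree_le_iff
  proof
    fix m assume "m \<in> Poly_Mapping.keys (q u)"
    then obtain a where "a < length Bs" "m = sqfree_monomial (Bs ! a)" using q_keys[of u] by blast
    then show "monomial_degree m \<le> t" using B by (simp add: monomial_degree_sqfree)
  qed
  have "eval_mpoly (q u) (indicator S) = (\<Sum>a<length Bs. of_bool (Bs ! a \<subseteq> S) * u a)" for u S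
    unfolding q_def eval_mpoly_sum eval_mpoly_single monomial_value_indicator
    by (rule sum.cong) (simp_all add: keys_sqfree_monomial B)
  then have "\<forall>S\<subseteq>V. eval_mpoly (p - (\<Sum>q\<leftarrow>map q us. q * q)) (indicator S) = 0"
    by (simp add: eval_mpoly_diff eval_mpoly_sum_list eval_mpoly_mult us power2_eq_square o_def)
  moreover have "p - (\<Sum>q\<leftarrow>map q us. q * q) \<in> polys_in V"
    by (rule polys_in_diff[OF p], rule polys_in_sum_list) (auto intro: polys_in_mult q_in)
  ultimately have "p - (\<Sum>q\<leftarrow>map q us. q ^ 2) \<in> boolean_ideal V"
    unfolding power2_eq_square by (simp only: boolean_ideal_iff_vanishes_on_cube[OF V])
  then show "sos_modulo t V (boolean_ideal V) p"
    unfolding sos_modulo_def using q_in q_deg by (intro exI[of _ "map q us"]) auto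
qed

section \<open>Gram matrices\<close>

lemma gram_quadratic_form:
  fixes us :: "('a \<Rightarrow> real) list"
  shows "(\<Sum>a\<in>I. \<Sum>b\<in>I. x a * (\<Sum>u\<leftarrow>us. u a * u b) * x b) = (\<Sum>u\<leftarrow>us. (\<Sum>a\<in>I. x a * u a)\<^sup>2)"
proof (induction us)
  case (Cons u us)
  have "(\<Sum>a\<in>I. x a * u a)\<^sup>2 = (\<Sum>a\<in>I. \<Sum>b\<in>I. x a * (u a * u b) * x b)"
    by (simp add: power2_eq_square sum_product mult_ac)
  then show ?case using Cons by (simp add: distrib_left distrib_right sum.distrib)
qed simp

lemma quadratic_form_matrix:
  fixes X :: "real mat"
  assumes "X \<in> carrier_mat s s" "v \<in> carrier_vec s"
  shows "v \<bullet> (X *\<^sub>v v) = (\<Sum>a<s. \<Sum>b<s. v $ a * X $$ (a, b) * v $ b)"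
  using assms by (auto simp: scalar_prod_def mult_mat_vec_def sum_distrib_left mult_ac
      lessThan_atLeast0 intro!: sum.cong)

lemma psd_matrix_iff_gram:
  assumes "X \<in> carrier_mat s s"
  shows "psd_matrix s X \<longleftrightarrow> (\<exists>us :: (nat \<Rightarrow> real) list. \<forall>a<s. \<forall>b<s. X $$ (a, b) = (\<Sum>u\<leftarrow>us. u a * u b))"
proof
  assume psd: "psd_matrix s X"
  have "X $$ (a, b) = X $$ (b, a)" if "a < s" "b < s" for a b
    using psd that by (metis assms carrier_matD index_transpose_mat(1) psd_matrix_def)
  moreover have "(\<Sum>a<s. \<Sum>b<s. x a * X $$ (a, b) * x b) \<ge> 0" for x
  proof -
    have "vec s x \<bullet> (X *\<^sub>v vec s x) \<ge> 0" using psd by (simp add: psd_matrix_def)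
    then show ?thesis by (simp add: quadratic_form_matrix[OF assms])
  qed
  ultimately show "\<exists>us :: (nat \<Rightarrow> real) list. \<forall>a<s. \<forall>b<s. X $$ (a, b) = (\<Sum>u\<leftarrow>us. u a * u b)"
    using psd_form_is_gram[of "{..<s}" "\<lambda>a b. X $$ (a, b)"] by auto
next
  assume "\<exists>us :: (nat \<Rightarrow> real) list. \<forall>a<s. \<forall>b<s. X $$ (a, b) = (\<Sum>u\<leftarrow>us. u a * u b)"
  then obtain us :: "(nat \<Rightarrow> real) list"
    where us: "\<And>a b. a < s \<Longrightarrow> b < s \<Longrightarrow> X $$ (a, b) = (\<Sum>u\<leftarrow>us. u a * u b)" by blast
  have "transpose_mat X = X"
    using assms us by (intro eq_matI) (auto simp: mult.commute)
  moreover have "v \<bullet> (X *\<^sub>v v) \<ge> 0" if "v \<in> carrier_vec s" for v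
  proof -
    have "v \<bullet> (X *\<^sub>v v) = (\<Sum>a<s. \<Sum>b<s. v $ a * (\<Sum>u\<leftarrow>us. u a * u b) * v $ b)"
      by (simp add: quadratic_form_matrix[OF assms that] us)
    then show ?thesis by (auto simp: gram_quadratic_form intro!: sum_list_nonneg)
  qed
  ultimately show "psd_matrix s X" using assms by (simp add: psd_matrix_def)
qed

text \<open>The rank-one matrix \<open>v\<^sub>S v\<^sub>S\<^sup>T\<close>, where \<open>v\<^sub>S\<close> lists the values at \<open>1\<^sub>S\<close> of the squarefree monomials
  given by \<open>Bs\<close>.\<close>

definition cube_point_matrix :: "nat set list \<Rightarrow> nat set \<Rightarrow> real mat" where
  "cube_point_matrix Bs S = mat (length Bs) (length Bs)
     (\<lambda>(a, b). of_bool (Bs ! a \<subseteq> S) * of_bool (Bs ! b \<subseteq> S))"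

lemma mat_inner_cube_point_matrix:
  "mat_inner (cube_point_matrix Bs S) X = (\<Sum>a<length Bs. \<Sum>b<length Bs.
     of_bool (Bs ! a \<subseteq> S) * X $$ (a, b) * of_bool (Bs ! b \<subseteq> S))"
  by (simp add: mat_inner_def cube_point_matrix_def mult_ac)

text \<open>The sums of squares of \<open>sos_modulo_iff_squares_on_cube\<close> depend on the vectors \<open>u\<close> only through
  their Gram matrix, and the Gram matrices are the positive semidefinite matrices.\<close>

lemma sos_modulo_iff_psd_matrix:
  assumes V: "finite V" and p: "p \<in> polys_in V"
    and Bs: "distinct Bs" "set Bs = small_subsets t V"
  shows "sos_modulo t V (boolean_ideal V) p \<longleftrightarrow>
    (\<exists>X. psd_matrix (length Bs) X \<and>
       (\<forall>S\<in>Pow V. mat_inner (cube_point_matrix Bs S) X = eval_mpoly p (indicator S)))"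
  unfolding sos_modulo_iff_squares_on_cube[OF assms]
proof
  assume "\<exists>us :: (nat \<Rightarrow> real) list. \<forall>S\<subseteq>V. eval_mpoly p (indicator S)
       = (\<Sum>u\<leftarrow>us. (\<Sum>a<length Bs. of_bool (Bs ! a \<subseteq> S) * u a)\<^sup>2)"
  then obtain us :: "(nat \<Rightarrow> real) list" where us: "\<forall>S\<subseteq>V. eval_mpoly p (indicator S)
       = (\<Sum>u\<leftarrow>us. (\<Sum>a<length Bs. of_bool (Bs ! a \<subseteq> S) * u a)\<^sup>2)" ..
  define X where "X = mat (length Bs) (length Bs) (\<lambda>(a, b). \<Sum>u\<leftarrow>us. u a * u b)"
  have "psd_matrix (length Bs) X"
    by (subst psd_matrix_iff_gram) (auto simp: X_def)
  moreover have "mat_inner (cube_point_matrix Bs S) X = eval_mpoly p (indicator S)" if "S \<subseteq> V" for S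
    unfolding mat_inner_cube_point_matrix us[rule_format, OF that] gram_quadratic_form[symmetric]
    by (simp add: X_def)
  ultimately show "\<exists>X. psd_matrix (length Bs) X \<and>
       (\<forall>S\<in>Pow V. mat_inner (cube_point_matrix Bs S) X = eval_mpoly p (indicator S))" by blast
next
  assume "\<exists>X. psd_matrix (length Bs) X \<and>
       (\<forall>S\<in>Pow V. mat_inner (cube_point_matrix Bs S) X = eval_mpoly p (indicator S))"
  then obtain X where X: "psd_matrix (length Bs) X"
    and eqs: "\<And>S. S \<subseteq> V \<Longrightarrow> mat_inner (cube_point_matrix Bs S) X = eval_mpoly p (indicator S)"
    by blast
  obtain us :: "(nat \<Rightarrow> real) list" where us:
    "\<And>a b. a < length Bs \<Longrightarrow> b < length Bs \<Longrightarrow> X $$ (a, b) = (\<Sum>u\<leftarrow>us. u a * u b)"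
    using X psd_matrix_iff_gram[of X "length Bs"] by (auto simp: psd_matrix_def)
  have squares: "eval_mpoly p (indicator S)
      = (\<Sum>u\<leftarrow>us. (\<Sum>a<length Bs. of_bool (Bs ! a \<subseteq> S) * u a)\<^sup>2)" if "S \<subseteq> V" for S
    unfolding eqs[OF that, symmetric] mat_inner_cube_point_matrix gram_quadratic_form[symmetric]
    by (simp add: us)
  show "\<exists>us :: (nat \<Rightarrow> real) list. \<forall>S\<subseteq>V. eval_mpoly p (indicator S)
       = (\<Sum>u\<leftarrow>us. (\<Sum>a<length Bs. of_bool (Bs ! a \<subseteq> S) * u a)\<^sup>2)"
    by (rule exI[of _ us], intro allI impI, rule squares)
qed

section \<open>The semidefinite program\<close>

text \<open>When every equation involves a single block, the blocks can be solved independently.\<close>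

lemma sdp_feasible_separable:
  assumes sizes: "block_sizes P = replicate L s"
    and eqs: "set (equations P) = (\<lambda>(r, c).
      (map (\<lambda>r'. if r' = r then A r c else 0\<^sub>m s s) [0..<L], b r c)) ` Sigma {..<L} K"
  shows "sdp_feasible P \<longleftrightarrow>
    (\<forall>r<L. \<exists>X. psd_matrix s X \<and> (\<forall>c\<in>K r. mat_inner (A r c) X = b r c))"
proof -
  define lhs where "lhs r c = map (\<lambda>r'. if r' = r then A r c else 0\<^sub>m s s) [0..<L]" for r c
  have collapse: "(\<Sum>r'<L. mat_inner (lhs r c ! r') (Xs ! r')) = mat_inner (A r c) (Xs ! r)"
    if "r < L" for r c Xs
  proof -
    have "(\<Sum>r'<L. mat_inner (lhs r c ! r') (Xs ! r'))
        = (\<Sum>r'<L. if r' = r then mat_inner (A r c) (Xs ! r) else 0)"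
      by (rule sum.cong) (auto simp: lhs_def mat_inner_def)
    then show ?thesis using that by simp
  qed
  have "(\<forall>(As, \<beta>)\<in>set (equations P). (\<Sum>r<L. mat_inner (As ! r) (Xs ! r)) = \<beta>)
      \<longleftrightarrow> (\<forall>r<L. \<forall>c\<in>K r. mat_inner (A r c) (Xs ! r) = b r c)" for Xs
    unfolding eqs[folded lhs_def] by (auto simp: collapse)
  then have "sdp_feasible P \<longleftrightarrow> (\<exists>Xs. length Xs = L \<and> (\<forall>r<L. psd_matrix s (Xs ! r)) \<and>
      (\<forall>r<L. \<forall>c\<in>K r. mat_inner (A r c) (Xs ! r) = b r c))"
    by (simp add: sdp_feasible_def sizes cong: conj_cong)
  also have "\<dots> \<longleftrightarrow> (\<forall>r<L. \<exists>X. psd_matrix s X \<and> (\<forall>c\<in>K r. mat_inner (A r c) X = b r c))"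
    (is "?L \<longleftrightarrow> ?R")
  proof
    assume ?R
    then obtain X where "\<And>r. r < L \<Longrightarrow> psd_matrix s (X r) \<and> (\<forall>c\<in>K r. mat_inner (A r c) (X r) = b r c)"
      by metis
    then show ?L by (intro exI[of _ "map X [0..<L]"]) simp
  qed blast
  finally show ?thesis .
qed

lemma card_ordered_pairs: "card {(i, j). i \<in> {1..n} \<and> j \<in> {1..n} \<and> i < j} = n * (n - 1) div 2"
proof -
  have "{(i, j). i \<in> {1..n} \<and> j \<in> {1..n} \<and> i < j} = (\<lambda>(j, i). (i, j)) ` (SIGMA j:{1..n}. {1..<j})"
    by force
  then have "card {(i, j). i \<in> {1..n} \<and> j \<in> {1..n} \<and> i < j} = card (SIGMA j:{1..n}. {1..<j})"
    by (simp add: card_image inj_on_def)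
  also have "\<dots> = (\<Sum>j=1..n. j - 1)" by simp
  also have "\<dots> = n * (n - 1) div 2"
  proof (induction n)
    case (Suc n)
    then show ?case by (cases n) (auto simp: algebra_simps)
  qed simp
  finally show ?thesis .
qed

text \<open>For \<open>i \<noteq> j\<close> outside of \<open>S\<close>: the coefficients of the linear form that sends a multilinear
  polynomial \<open>F\<close> to the value of \<open>- \<partial>\<^sub>i \<partial>\<^sub>j F\<close> at \<open>1\<^sub>S\<close>.\<close>

definition neg_second_partial_form :: "nat \<Rightarrow> nat \<Rightarrow> nat set \<Rightarrow> nat set \<Rightarrow> real" where
  "neg_second_partial_form i j S U = (if i \<in> U \<and> j \<in> U \<and> U - {i, j} \<subseteq> S then - 1 else 0)"

text \<open>The second derivative moves the coefficient of \<open>F\<close> at \<open>T \<union> {i, j}\<close> to \<open>T\<close>, and evaluation at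
  \<open>1\<^sub>S\<close> adds the coefficients at all \<open>T \<subseteq> S\<close>.\<close>

lemma eval_neg_second_partial:
  assumes F: "multilinear F" "F \<in> polys_in W" and W: "finite W"
    and ij: "i \<noteq> j" "i \<in> W" "j \<in> W" and S: "S \<subseteq> W - {i, j}"
  shows "eval_mpoly (- partial_deriv i (partial_deriv j F)) (indicator S)
    = (\<Sum>U\<in>Pow W. neg_second_partial_form i j S U * Poly_Mapping.lookup F (sqfree_monomial U))"
proof -
  let ?h = "\<lambda>T. insert i (insert j T)"
  have "inj_on ?h (Pow S)"
    by (rule inj_on_inverseI[where g = "\<lambda>U. U - {i, j}"]) (use S in auto)
  moreover have "?h ` Pow S = {U \<in> Pow W. i \<in> U \<and> j \<in> U \<and> U - {i, j} \<subseteq> S}"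
  proof (intro equalityI subsetI)
    fix U assume "U \<in> {U \<in> Pow W. i \<in> U \<and> j \<in> U \<and> U - {i, j} \<subseteq> S}"
    then have "U = ?h (U - {i, j})" "U - {i, j} \<in> Pow S" by auto
    then show "U \<in> ?h ` Pow S" by blast
  qed (use S ij in auto)
  ultimately have "(\<Sum>T\<in>Pow S. Poly_Mapping.lookup F (sqfree_monomial (?h T)))
      = (\<Sum>U\<in>{U \<in> Pow W. i \<in> U \<and> j \<in> U \<and> U - {i, j} \<subseteq> S}. Poly_Mapping.lookup F (sqfree_monomial U))"
    using sum.reindex[of ?h "Pow S" "\<lambda>U. Poly_Mapping.lookup F (sqfree_monomial U)"] by simp
  also have "- \<dots> = (\<Sum>U\<in>Pow W.
      neg_second_partial_form i j S U * Poly_Mapping.lookup F (sqfree_monomial U))"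
    unfolding sum_negf[symmetric]
    by (rule sum.mono_neutral_cong_left) (use W in \<open>auto simp: neg_second_partial_form_def\<close>)
  finally show ?thesis
    by (simp add: eval_mpoly_uminus eval_second_partial_indicator[OF F W ij(1) S])
qed

theorem proposition4:
  fixes n t :: nat
  shows "\<exists>(sizes :: nat list) (eqs :: (real mat list \<times> (nat set \<Rightarrow> real)) list).
    length sizes = n * (n - 1) div 2 \<and>
    (\<forall>s \<in> set sizes. s = (\<Sum>k=0..t. (n - 2) choose k)) \<and>
    (\<forall>f :: nat set \<Rightarrow> real.
       sdp_wf (sdp_at n sizes eqs (mle n f)) \<and>
       (sos_submodular n t f \<longleftrightarrow> sdp_feasible (sdp_at n sizes eqs (mle n f))))"
proof -
  define s where "s = (\<Sum>k=0..t. (n - 2) choose k)"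
  define pairs where "pairs = {(i, j). i \<in> {1..n} \<and> j \<in> {1..n} \<and> i < j}"
  have "finite pairs" by (rule finite_subset[of _ "{1..n} \<times> {1..n}"]) (auto simp: pairs_def)
  then obtain ps where ps: "distinct ps" "set ps = pairs" using finite_distinct_list by blast
  define L where "L = length ps"
  have L: "L = n * (n - 1) div 2"
    using distinct_card[OF ps(1)] ps(2) card_ordered_pairs[of n] by (simp add: L_def pairs_def)
  define V where "V r = {1..n} - {fst (ps ! r), snd (ps ! r)}" for r
  have finV: "finite (V r)" for r by (simp add: V_def)
  have "\<exists>Bs. distinct Bs \<and> set Bs = small_subsets t (V r)" for r
    using finite_distinct_list[OF finite_small_subsets[OF finV]] by blast
  then obtain Bs where Bs: "\<And>r. distinct (Bs r)" "\<And>r. set (Bs r) = small_subsets t (V r)" by metis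
  have pair: "fst (ps ! r) \<in> {1..n}" "snd (ps ! r) \<in> {1..n}" "fst (ps ! r) < snd (ps ! r)"
    if "r < L" for r
  proof -
    have "ps ! r \<in> pairs" using that unfolding ps(2)[symmetric] L_def by (rule nth_mem)
    then show "fst (ps ! r) \<in> {1..n}" "snd (ps ! r) \<in> {1..n}" "fst (ps ! r) < snd (ps ! r)"
      by (simp_all add: pairs_def case_prod_beta)
  qed
  have len: "length (Bs r) = s" if "r < L" for r
  proof -
    have "card (V r) = n - 2" using pair[OF that] by (simp add: V_def card_Diff_subset)
    then show ?thesis
      using distinct_card[OF Bs(1), of r] card_small_subsets[OF finV, of t r]
      by (simp add: Bs(2) s_def)
  qed
  define A where "A r S = cube_point_matrix (Bs r) S" for r S
  \<comment> \<open>One equation for each block \<open>r\<close> and each vertex \<open>S\<close> of its cube; the zero matrices decouple it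
    from the other blocks.\<close>
  define lhs where "lhs r S = map (\<lambda>r'. if r' = r then A r S else 0\<^sub>m s s) [0..<L]" for r S
  define form where "form r S = neg_second_partial_form (fst (ps ! r)) (snd (ps ! r)) S" for r S
  have "finite ((\<lambda>(r, S). (lhs r S, form r S)) ` (SIGMA r:{..<L}. Pow (V r)))"
    by (simp add: finV)
  from finite_list[OF this]
  obtain eqs where eqs: "set eqs = (\<lambda>(r, S). (lhs r S, form r S)) ` (SIGMA r:{..<L}. Pow (V r))" ..
  let ?P = "\<lambda>f. sdp_at n (replicate L s) eqs (mle n f)"
  have sym: "A r S \<in> carrier_mat s s" "transpose_mat (A r S) = A r S" if "r < L" for r S
    using len[OF that] by (auto simp: A_def cube_point_matrix_def)
  have "sdp_wf (?P f)" for f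
    unfolding sdp_wf_def using sym
    by (auto simp: sdp_at_def eqs lhs_def)
  moreover have "sos_submodular n t f \<longleftrightarrow> sdp_feasible (?P f)" for f
  proof -
    let ?D = "\<lambda>i j. - partial_deriv i (partial_deriv j (mle n f))"
    let ?sos = "\<lambda>i j. sos_modulo t ({1..n} - {i, j}) (boolean_ideal ({1..n} - {i, j})) (?D i j)"
    have F: "multilinear (mle n f)" "mle n f \<in> polys_in {1..n}"
      using is_mle_mle[of n f] by (auto simp: is_mle_def)
    define b where
      "b r S = (\<Sum>U\<in>Pow {1..n}. form r S U * Poly_Mapping.lookup (mle n f) (sqfree_monomial U))" for r S
    have "sos_submodular n t f \<longleftrightarrow> (\<forall>(i, j)\<in>pairs. ?sos i j)"
    proof
      assume R: "\<forall>(i, j)\<in>pairs. ?sos i j"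
      have swap: "?sos i j = ?sos j i" for i j
        by (simp add: insert_commute partial_deriv_commute[of i j])
      show "sos_submodular n t f"
        unfolding sos_submodular_def
      proof (intro ballI impI)
        fix i j assume "i \<in> {1..n}" "j \<in> {1..n}" "i \<noteq> j"
        then have "(i, j) \<in> pairs \<or> (j, i) \<in> pairs" by (auto simp: pairs_def)
        then show "?sos i j" using R swap by blast
      qed
    qed (auto simp: sos_submodular_def pairs_def)
    also have "\<dots> \<longleftrightarrow> (\<forall>r<L. ?sos (fst (ps ! r)) (snd (ps ! r)))"
      unfolding ps(2)[symmetric] L_def by (auto simp: all_set_conv_all_nth case_prod_beta)
    also have "\<dots> \<longleftrightarrow> (\<forall>r<L. \<exists>X. psd_matrix s X \<and> (\<forall>S\<in>Pow (V r). mat_inner (A r S) X = b r S))"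
    proof (intro all_cong)
      fix r assume r: "r < L"
      let ?i = "fst (ps ! r)" and ?j = "snd (ps ! r)"
      have ij: "?i \<noteq> ?j" using pair[OF r] by simp
      have "?D ?i ?j \<in> polys_in (V r)"
        unfolding V_def by (intro polys_in_uminus multilinear_second_partial(2)[OF F ij])
      moreover have "eval_mpoly (?D ?i ?j) (indicator S) = b r S" if "S \<in> Pow (V r)" for S
        using eval_neg_second_partial[OF F _ ij pair(1,2)[OF r]] that by (simp add: b_def form_def V_def)
      ultimately show "?sos ?i ?j \<longleftrightarrow>
          (\<exists>X. psd_matrix s X \<and> (\<forall>S\<in>Pow (V r). mat_inner (A r S) X = b r S))"
        using sos_modulo_iff_psd_matrix[OF finV _ Bs(1) Bs(2), of "?D ?i ?j" r]
        unfolding V_def[symmetric] by (simp add: len[OF r] A_def)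
    qed
    also have "\<dots> \<longleftrightarrow> sdp_feasible (?P f)"
      by (rule sdp_feasible_separable[symmetric])
         (force simp: sdp_at_def eqs lhs_def b_def)+
    finally show ?thesis .
  qed
  ultimately show ?thesis
    by (intro exI[of _ "replicate L s"] exI[of _ eqs]) (simp add: L s_def)
qed

end
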